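(* Let $R$ and $S$ be finite sets of intervals, let $\epsilon > 0$, and let $r \in R$ and $s \in S$ satisfy $|r| \geq \epsilon$ and $|s| \geq \epsilon$. Put $\theta_{start}(r) = r.end - \epsilon$ and $\theta_{end}(r) = r.start + \epsilon$. Then: (i) if $s.start \leq r.start$ and $\theta_{end}(r) \leq s.end$, then $(r,s) \in R \bowtie_{\epsilon} S$; (ii) if $\theta_{start}(r) < s.start$ or $s.end < \theta_{end}(r)$, then $(r,s) \notin R \bowtie_{\epsilon} S$.
   Context: An interval $r = [r.start, r.end]$ is given by real endpoints $r.start \leq r.end$; its length is $|r| = r.end - r.start$. For intervals $r,s$ the overlap duration is $l(r,s) = \min\{r.end, s.end\} - \max\{r.start, s.start\}$. The interval join is $R \bowtie S = \{(r,s) : r \in R, s \in S, r.start \leq s.end \text{ and } s.start \leq r.end\}$, and the duration-constrained interval join is $R \bowtie_{\epsilon} S = \{(r,s) \in R \bowtie S : l(r,s) \geq \epsilon\}$. *)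

theory Defs
  imports Complex_Main "HOL-Library.Interval"
begin

text \<open>
  An interval is an element of the library type \<^typ>\<open>real interval\<close>, a pair of endpoints with
  \<^prop>\<open>lower r \<le> upper r\<close>; thus \<^term>\<open>lower r\<close> is r.start, \<^term>\<open>upper r\<close> is r.end, and
  \<^term>\<open>width r\<close> is the length of r.
\<close>

text \<open>Negative when the two intervals are disjoint.\<close>
definition overlap_duration :: "real interval \<Rightarrow> real interval \<Rightarrow> real" where
  "overlap_duration r s = min (upper r) (upper s) - max (lower r) (lower s)"

definition interval_join ::
    "real interval set \<Rightarrow> real interval set \<Rightarrow> (real interval \<times> real interval) set" where
  "interval_join R S = {(r, s). r \<in> R \<and> s \<in> S \<and> lower r \<le> upper s \<and> lower s \<le> upper r}"

definition duration_join ::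
    "real \<Rightarrow> real interval set \<Rightarrow> real interval set \<Rightarrow> (real interval \<times> real interval) set" where
  "duration_join \<epsilon> R S = {(r, s) \<in> interval_join R S. overlap_duration r s \<ge> \<epsilon>}"

definition theta_start :: "real \<Rightarrow> real interval \<Rightarrow> real" where
  "theta_start \<epsilon> r = upper r - \<epsilon>"

definition theta_end :: "real \<Rightarrow> real interval \<Rightarrow> real" where
  "theta_end \<epsilon> r = lower r + \<epsilon>"

end

theory Submission
  imports Defs
begin

text \<open>The overlap is the least of the four differences upper end minus lower end. In (i) the
  larger lower end is \<open>lower r\<close>, and both upper ends are at least
  \<open>lower r + \<epsilon>\<close>; in (ii) one mixed difference,
  \<open>upper r - lower s\<close> or \<open>upper s - lower r\<close>, is below
  \<open>\<epsilon>\<close>.\<close>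

theorem theorem1:
  fixes R S :: "real interval set" and \<epsilon> :: real and r s :: "real interval"
  assumes "finite R" and "finite S"
    and "\<epsilon> > 0"
    and "r \<in> R" and "s \<in> S"
    and "width r \<ge> \<epsilon>" and "width s \<ge> \<epsilon>"
  shows "(lower s \<le> lower r \<and> theta_end \<epsilon> r \<le> upper s \<longrightarrow> (r, s) \<in> duration_join \<epsilon> R S)
    \<and> (theta_start \<epsilon> r < lower s \<or> upper s < theta_end \<epsilon> r \<longrightarrow> (r, s) \<notin> duration_join \<epsilon> R S)"
  \<comment> \<open>This gives \<open>lower s \<le> lower r \<le> upper r\<close> in (i), one of the
    two join conditions; the other follows from \<open>\<epsilon> > 0\<close>.\<close>
  using assms lower_le_upper[of r]
  by (auto simp: duration_join_def interval_join_def overlap_duration_def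
      theta_start_def theta_end_def width_def min_def max_def split: if_splits)

end
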